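(* Let $n\ge 12$, $k\in\{2,\dots,n-10\}$, $s\in\{0,\dots,\lfloor\frac{k-2}{2}\rfloor\}$, and let $p^{(k-2s)}$ be a homogeneous polynomial on $\mathbb{R}^n$ of degree $k-2s$ with $\Delta p^{(k-2s)}=0$. Write $r=|x|$. Then the equation on $\mathbb{R}^n$ $$\Delta^3\Psi+(n-4)(n-2)n(n+2)(n+4)(n+6)(1+r^2)^{-6}\Psi=-\mathfrak{L}_1[r^{2s}p^{(k-2s)}]w,$$ where $$\mathfrak{L}_1[r^{2s}p^{(k-2s)}]w:=-\frac{n-6}{4(n-1)}\Big[\mathsf{c}_1r^{2s-4}(1+r^2)^{-\frac{n-6}{2}}+\mathsf{c}_2r^{2s-2}(1+r^2)^{-\frac{n-4}{2}}+\mathsf{c}_3r^{2s}(1+r^2)^{-\frac{n-2}{2}}+\mathsf{c}_4r^{2s+2}(1+r^2)^{-\frac n2}+\mathsf{c}_5r^{2s+4}(1+r^2)^{-\frac{n+2}{2}}\Big]p^{(k-2s)},$$ has a solution of the form $$\Psi^{k,s}=\frac{n-6}{4(n-1)}\sum_{j=1}^{s+3}\Gamma_j(1+r^2)^{-\frac{n-2-2j}{2}}p^{(k-2s)},$$ where the real numbers $\Gamma_j=\Gamma_j(n,k,s)$ satisfy $$(k-2s-1)\Gamma_1=2\Gamma_2,\qquad (k-2s)\Gamma_2=\frac{4(n-1)}{n-2}\Gamma_3,$$ $$(k-2s+j-2)\Gamma_j=\frac{2j(n-j+1)}{n-2j+2}\Gamma_{j+1}-\frac{(-1)^{s+3-j}}{2(n-2j+2)}\binom{s}{j-3}\qquad\text{for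 }j=3,\dots,s+2,$$ $$(k-s+1)\Gamma_{s+3}=-\frac{1}{2(n-2s-4)}.$$
   Context: Here $w(x)=(1+|x|^2)^{-\frac{n-6}{2}}$, so that $w^{\frac{12}{n-6}}=(1+r^2)^{-6}$, and $\mathsf{c}_1=2s(2k-2s+n-2)(2s-2)(2k-2s+n-4)$; $\mathsf{c}_2=-2s(2k-2s+n-2)(4(n-8)k+3n^2-18n+8)$; $\mathsf{c}_3=4(n-8)(n-6)k^2+2(n-6)(3n^2-12n-40)k+2s(2k-2s+n-2)(3n^2-26n+72)+3n^4-12n^3-44n^2+176n+192$; $\mathsf{c}_4=-2(n-4)\big[(3n^2-28n+60)k+3(n^3-2n^2-4n+40)\big]$; $\mathsf{c}_5=(n-4)n(3n^2-12n+44)$. Terms with negative powers of $r$ have zero coefficient. *)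

theory Defs
  imports "HOL-Analysis.Analysis"
begin

definition partial_deriv :: "'n::finite \<Rightarrow> (real ^ 'n \<Rightarrow> real) \<Rightarrow> real ^ 'n \<Rightarrow> real" where
  "partial_deriv i f x = deriv (\<lambda>t. f (x + t *\<^sub>R axis i 1)) 0"

definition laplacian :: "(real ^ 'n::finite \<Rightarrow> real) \<Rightarrow> real ^ 'n \<Rightarrow> real" where
  "laplacian f x = (\<Sum>i\<in>UNIV. partial_deriv i (partial_deriv i f) x)"

text \<open>\<open>C_class m f\<close>: \<open>f\<close> is of class \<open>C\<close>$^m$ on all of \<open>\<real>\<close>$^n$. Since \<^const>\<open>deriv\<close> is total, a
  differential equation written with \<^const>\<open>laplacian\<close> has its intended meaning only together
  with such a regularity condition.\<close>

primrec C_class :: "nat \<Rightarrow> (real ^ 'n::finite \<Rightarrow> real) \<Rightarrow> bool" where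
  "C_class 0 f \<longleftrightarrow> continuous_on UNIV f"
| "C_class (Suc m) f \<longleftrightarrow> (\<forall>x. f differentiable (at x)) \<and> (\<forall>i. C_class m (partial_deriv i f))"

definition multi_indices :: "nat \<Rightarrow> ('n::finite \<Rightarrow> nat) set" where
  "multi_indices d = {\<alpha>. (\<Sum>i\<in>UNIV. \<alpha> i) = d}"

lemma finite_multi_indices: "finite (multi_indices d :: ('n::finite \<Rightarrow> nat) set)"
proof (rule finite_subset)
  show "multi_indices d \<subseteq> (PiE UNIV (\<lambda>_. {..d}) :: ('n \<Rightarrow> nat) set)"
    by (auto simp: multi_indices_def intro!: member_le_sum)
  show "finite (PiE UNIV (\<lambda>_. {..d}) :: ('n \<Rightarrow> nat) set)"
    by (intro finite_PiE) auto
qed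

definition homogeneous_polynomial :: "nat \<Rightarrow> (real ^ 'n::finite \<Rightarrow> real) \<Rightarrow> bool" where
  "homogeneous_polynomial d p \<longleftrightarrow>
     (\<exists>a. \<forall>x. p x = (\<Sum>\<alpha>\<in>multi_indices d. a \<alpha> * (\<Prod>i\<in>UNIV. (x $ i) ^ \<alpha> i)))"

definition c1 :: "real \<Rightarrow> real \<Rightarrow> real \<Rightarrow> real" where
  "c1 n k s = 2 * s * (2 * k - 2 * s + n - 2) * (2 * s - 2) * (2 * k - 2 * s + n - 4)"

definition c2 :: "real \<Rightarrow> real \<Rightarrow> real \<Rightarrow> real" where
  "c2 n k s = -2 * s * (2 * k - 2 * s + n - 2) * (4 * (n - 8) * k + 3 * n^2 - 18 * n + 8)"

definition c3 :: "real \<Rightarrow> real \<Rightarrow> real \<Rightarrow> real" where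
  "c3 n k s = 4 * (n - 8) * (n - 6) * k^2 + 2 * (n - 6) * (3 * n^2 - 12 * n - 40) * k
     + 2 * s * (2 * k - 2 * s + n - 2) * (3 * n^2 - 26 * n + 72)
     + 3 * n^4 - 12 * n^3 - 44 * n^2 + 176 * n + 192"

definition c4 :: "real \<Rightarrow> real \<Rightarrow> real" where
  "c4 n k = -2 * (n - 4) * ((3 * n^2 - 28 * n + 60) * k + 3 * (n^3 - 2 * n^2 - 4 * n + 40))"

definition c5 :: "real \<Rightarrow> real" where
  "c5 n = (n - 4) * n * (3 * n^2 - 12 * n + 44)"

text \<open>\<open>L1w n k s p x\<close> is the value at \<open>x\<close> of $\mathfrak{L}_1[r^{2s}p]w$, where
  $w = (1+r^2)^{-(n-6)/2}$ and \<open>p\<close> has degree \<open>k - 2s\<close>. The powers of \<open>r\<close> are integer powers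
  (\<^const>\<open>power_int\<close>), so that $r^0 = 1$ also at the origin. A negative exponent occurs only for
  \<open>s \<le> 1\<close> in the first and \<open>s = 0\<close> in the second term, where \<^const>\<open>c1\<close>, respectively
  \<^const>\<open>c2\<close>, vanishes.\<close>

definition L1w :: "nat \<Rightarrow> nat \<Rightarrow> nat \<Rightarrow> (real ^ 'n::finite \<Rightarrow> real) \<Rightarrow> real ^ 'n \<Rightarrow> real" where
  "L1w n k s p x =
     - ((real n - 6) / (4 * (real n - 1))) *
       ( c1 (real n) (real k) (real s) * norm x powi (2 * int s - 4)
           * (1 + (norm x)^2) powr (- ((real n - 6) / 2))
       + c2 (real n) (real k) (real s) * norm x powi (2 * int s - 2)
           * (1 + (norm x)^2) powr (- ((real n - 4) / 2))
       + c3 (real n) (real k) (real s) * norm x powi (2 * int s)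
           * (1 + (norm x)^2) powr (- ((real n - 2) / 2))
       + c4 (real n) (real k) * norm x powi (2 * int s + 2)
           * (1 + (norm x)^2) powr (- (real n / 2))
       + c5 (real n) * norm x powi (2 * int s + 4)
           * (1 + (norm x)^2) powr (- ((real n + 2) / 2)))
       * p x"

definition Psi :: "(nat \<Rightarrow> real) \<Rightarrow> nat \<Rightarrow> nat \<Rightarrow> (real ^ 'n::finite \<Rightarrow> real) \<Rightarrow> real ^ 'n \<Rightarrow> real" where
  "Psi \<Gamma> n s p x = (real n - 6) / (4 * (real n - 1)) *
     (\<Sum>j=1..s+3. \<Gamma> j * (1 + (norm x)^2) powr (- ((real n - 2 - 2 * real j) / 2)) * p x)"

end

theory Submission
  imports Defs
begin

text \<open>
  Put \<open>u = 1 + r\<^sup>2\<close>, \<open>v = r\<^sup>2\<close>, \<open>d = k - 2 s\<close>. On the functions \<open>u powr a * p\<close> the Laplacian acts by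
  \<open>4 a (a - 1 + n / 2 + d) u powr (a - 1) * p - 4 a (a - 1) u powr (a - 2) * p\<close>, so the equation becomes a
  four-term relation between coefficients. In stereographic coordinates the linearized operator is
  a cubic polynomial in the spherical Laplacian that vanishes on first-order spherical
  harmonics; hence it splits off a linear factor, and this factor acts on
  \<open>u powr (j + 1 - n / 2) * p\<close> by a two-term formula. The stated recursion for \<open>\<Gamma>\<close> says that the linear factor
  sends the sum with coefficients \<open>\<Gamma>\<close> to a multiple of \<open>u powr (5 - n / 2) * v ^ s * p\<close>, and the remaining quadratic
  factor applied to this function produces the five terms of the right-hand side.
\<close>

subsection \<open>Calculus with the Laplacian\<close>

text \<open>Chain rule along the line through \<open>x\<close> in direction \<open>axis i 1\<close>.
  It carries the calculus of Frechet derivatives over to \<open>partial_deriv\<close>, which is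
  defined through the total \<open>deriv\<close>.\<close>

lemma partial_deriv_eq:
  assumes "(f has_derivative f') (at x)"
  shows "partial_deriv i f x = f' (axis i 1)"
proof -
  have "((\<lambda>t. x + t *\<^sub>R axis i 1) has_derivative (\<lambda>t. t *\<^sub>R axis i 1)) (at (0::real))"
    by (auto intro!: derivative_eq_intros)
  then have "((\<lambda>t. f (x + t *\<^sub>R axis i 1)) has_derivative (\<lambda>t. f' (t *\<^sub>R axis i 1))) (at 0)"
    using assms by (intro has_derivative_compose[where f = "\<lambda>t. x + t *\<^sub>R axis i 1" and g = f]) auto
  moreover have "(\<lambda>t. f' (t *\<^sub>R axis i 1)) = (*) (f' (axis i 1))"
    using has_derivative_bounded_linear[OF assms]
    by (auto simp: bounded_linear.linear linear_scale fun_eq_iff)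
  ultimately show ?thesis
    unfolding partial_deriv_def by (intro DERIV_imp_deriv) (simp add: has_field_derivative_def)
qed

lemma partial_deriv_const: "partial_deriv i (\<lambda>_. c) = (\<lambda>_. 0)"
  by (auto simp: fun_eq_iff intro!: partial_deriv_eq[where f' = "\<lambda>_. 0"])

lemma partial_deriv_nth:
  fixes i j :: "'n::finite"
  shows "partial_deriv i (\<lambda>x. x $ j) = (\<lambda>_. if i = j then 1 else 0)"
proof
  fix x :: "real ^ 'n"
  have "((\<lambda>x. x $ j) has_derivative (\<lambda>h. h $ j)) (at x)"
    by (rule bounded_linear_imp_has_derivative) (rule bounded_linear_vec_nth)
  from partial_deriv_eq[OF this, of i]
  show "partial_deriv i (\<lambda>x. x $ j) x = (if i = j then 1 else 0)"
    by (auto simp: axis_def)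
qed

lemma partial_deriv_add:
  assumes "f differentiable (at x)" "g differentiable (at x)"
  shows "partial_deriv i (\<lambda>x. f x + g x) x = partial_deriv i f x + partial_deriv i g x"
proof -
  obtain f' g' where *: "(f has_derivative f') (at x)" "(g has_derivative g') (at x)"
    using assms by (auto simp: differentiable_def)
  show ?thesis
    using partial_deriv_eq[OF has_derivative_add[OF *]] *[THEN partial_deriv_eq] by simp
qed

lemma partial_deriv_mult:
  assumes "f differentiable (at x)" "g differentiable (at x)"
  shows "partial_deriv i (\<lambda>x. f x * g x) x = f x * partial_deriv i g x + partial_deriv i f x * g x"
proof -
  obtain f' g' where *: "(f has_derivative f') (at x)" "(g has_derivative g') (at x)"
    using assms by (auto simp: differentiable_def)
  show ?thesis
    using partial_deriv_eq[OF has_derivative_mult[OF *]] *[THEN partial_deriv_eq] by simp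
qed

section \<open>Differentiability classes and their closure properties\<close>

lemma C_class_differentiable: "C_class (Suc m) f \<Longrightarrow> f differentiable (at x)"
  by simp

lemma C_class_Suc_imp: "C_class (Suc m) f \<Longrightarrow> C_class m f"
proof (induction m arbitrary: f)
  case 0
  then show ?case
    by (simp add: continuous_at_imp_continuous_on differentiable_imp_continuous_within)
qed simp

lemma C_class_mono:
  assumes "m \<le> m'" "C_class m' f"
  shows "C_class m f"
  using assms by (induction rule: dec_induct) (use C_class_Suc_imp in blast)+

lemma C_class_const: "C_class m (\<lambda>_. c)"
  by (induction m arbitrary: c) (auto simp: partial_deriv_const)

lemma C_class_nth: "C_class m (\<lambda>x. x $ j)"
proof (cases m)
  case 0
  then show ?thesis by (simp add: continuous_on_component)
next
  case (Suc m')
  have "(\<lambda>x. x $ j) differentiable (at x)" for x :: "real ^ 'a"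
    by (rule bounded_linear_imp_differentiable) (rule bounded_linear_vec_nth)
  then show ?thesis by (simp add: Suc partial_deriv_nth C_class_const)
qed

lemma C_class_add:
  "C_class m f \<Longrightarrow> C_class m g \<Longrightarrow> C_class m (\<lambda>x. f x + g x)"
proof (induction m arbitrary: f g)
  case (Suc m)
  have "partial_deriv i (\<lambda>x. f x + g x) = (\<lambda>x. partial_deriv i f x + partial_deriv i g x)" for i
    using Suc.prems by (auto simp: partial_deriv_add)
  with Suc show ?case by auto
qed (auto intro!: continuous_intros)

lemma C_class_mult:
  "C_class m f \<Longrightarrow> C_class m g \<Longrightarrow> C_class m (\<lambda>x. f x * g x)"
proof (induction m arbitrary: f g)
  case (Suc m)
  have "partial_deriv i (\<lambda>x. f x * g x)
      = (\<lambda>x. f x * partial_deriv i g x + partial_deriv i f x * g x)" for i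
    using Suc.prems by (auto simp: partial_deriv_mult)
  \<comment> \<open>The product rule leaves one factor undifferentiated in each term, so the
    induction hypothesis is also applied to \<open>f\<close> and \<open>g\<close> themselves, one
    class lower.\<close>
  moreover have "C_class m f" "C_class m g"
    using Suc.prems C_class_Suc_imp by blast+
  ultimately show ?case
    using Suc by (auto intro!: C_class_add)
qed (auto intro!: continuous_intros)

lemma C_class_sum: "(\<And>i. i \<in> I \<Longrightarrow> C_class m (f i)) \<Longrightarrow> C_class m (\<lambda>x. \<Sum>i\<in>I. f i x)"
  by (induction I rule: infinite_finite_induct) (auto intro!: C_class_const C_class_add)

lemma C_class_prod: "(\<And>i. i \<in> I \<Longrightarrow> C_class m (f i)) \<Longrightarrow> C_class m (\<lambda>x. \<Prod>i\<in>I. f i x)"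
  by (induction I rule: infinite_finite_induct) (auto intro!: C_class_const C_class_mult)

lemma C_class_power: "C_class m f \<Longrightarrow> C_class m (\<lambda>x. f x ^ k)"
  by (induction k) (auto intro!: C_class_const C_class_mult)

lemma C_class_homogeneous_polynomial:
  assumes "homogeneous_polynomial d p"
  shows "C_class m p"
proof -
  obtain a where "p = (\<lambda>x. \<Sum>\<alpha>\<in>multi_indices d. a \<alpha> * (\<Prod>i\<in>UNIV. (x $ i) ^ \<alpha> i))"
    using assms by (auto simp: homogeneous_polynomial_def fun_eq_iff)
  then show ?thesis
    by (simp only:) (intro C_class_sum C_class_mult C_class_const C_class_prod C_class_power C_class_nth)
qed

section \<open>Product rule and linearity of the Laplacian, Euler's identity\<close>

lemma laplacian_mult:
  assumes f: "C_class 2 f" and g: "C_class 2 g"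
  shows "laplacian (\<lambda>x. f x * g x) x
    = f x * laplacian g x + 2 * (\<Sum>i\<in>UNIV. partial_deriv i f x * partial_deriv i g x)
      + laplacian f x * g x"
proof -
  have d: "f differentiable at x" "g differentiable at x"
    "partial_deriv i f differentiable at x" "partial_deriv i g differentiable at x" for x i
    using f g by (simp_all add: numeral_2_eq_2)
  have 1: "partial_deriv i (\<lambda>x. f x * g x)
      = (\<lambda>x. f x * partial_deriv i g x + partial_deriv i f x * g x)" for i
    using d by (auto simp: partial_deriv_mult)
  have "partial_deriv i (partial_deriv i (\<lambda>x. f x * g x)) x
      = f x * partial_deriv i (partial_deriv i g) x
        + 2 * (partial_deriv i f x * partial_deriv i g x)
        + partial_deriv i (partial_deriv i f) x * g x" for i
    unfolding 1 by (simp add: partial_deriv_add partial_deriv_mult d differentiable_mult)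
  then have "laplacian (\<lambda>x. f x * g x) x
      = (\<Sum>i\<in>UNIV. f x * partial_deriv i (partial_deriv i g) x
        + 2 * (partial_deriv i f x * partial_deriv i g x)
        + partial_deriv i (partial_deriv i f) x * g x)"
    by (simp only: laplacian_def)
  then show ?thesis
    unfolding laplacian_def by (simp add: sum.distrib sum_distrib_left[symmetric] sum_distrib_right[symmetric])
qed

lemma laplacian_add:
  assumes f: "C_class 2 f" and g: "C_class 2 g"
  shows "laplacian (\<lambda>x. f x + g x) x = laplacian f x + laplacian g x"
proof -
  have d: "f differentiable at x" "g differentiable at x"
    "partial_deriv i f differentiable at x" "partial_deriv i g differentiable at x" for x i
    using f g by (simp_all add: numeral_2_eq_2)
  have 1: "partial_deriv i (\<lambda>x. f x + g x) = (\<lambda>x. partial_deriv i f x + partial_deriv i g x)" for i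
    using d by (auto simp: partial_deriv_add)
  show ?thesis
    unfolding laplacian_def 1 by (simp add: partial_deriv_add sum.distrib d)
qed

lemma laplacian_const: "laplacian (\<lambda>_. c) x = 0"
  by (simp add: laplacian_def partial_deriv_const)

lemma laplacian_cmult:
  "C_class 2 f \<Longrightarrow> laplacian (\<lambda>x. c * f x) x = c * laplacian f x"
  by (simp add: laplacian_mult C_class_const laplacian_const partial_deriv_const)

lemma laplacian_sum:
  assumes "\<And>i. i \<in> I \<Longrightarrow> C_class 2 (f i)"
  shows "laplacian (\<lambda>x. \<Sum>i\<in>I. f i x) x = (\<Sum>i\<in>I. laplacian (f i) x)"
  using assms
  by (induction I rule: infinite_finite_induct)
    (auto simp: laplacian_const laplacian_add C_class_sum)

text \<open>Differentiate \<open>p (t *\<^sub>R x) = t ^ d * p x\<close> at \<open>t = 1\<close> in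
  two ways. Expanding \<open>x\<close> in the standard basis turns the derivative in direction
  \<open>x\<close> into the sum.\<close>

lemma euler_homogeneous:
  fixes p :: "real ^ 'n::finite \<Rightarrow> real"
  assumes "homogeneous_polynomial d p"
  shows "(\<Sum>i\<in>UNIV. x $ i * partial_deriv i p x) = real d * p x"
proof -
  obtain a where p: "p = (\<lambda>x. \<Sum>\<alpha>\<in>multi_indices d. a \<alpha> * (\<Prod>i\<in>UNIV. (x $ i) ^ \<alpha> i))"
    using assms by (auto simp: homogeneous_polynomial_def fun_eq_iff)
  have scale: "p (t *\<^sub>R x) = t ^ d * p x" for t
    unfolding p
    by (auto simp: sum_distrib_left power_mult_distrib prod.distrib power_sum[symmetric]
        multi_indices_def mult_ac intro!: sum.cong)
  have "C_class (Suc 0) p" by (rule C_class_homogeneous_polynomial[OF assms])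
  then obtain p' where p': "(p has_derivative p') (at x)"
    by (auto simp: differentiable_def)
  then interpret p': bounded_linear p' by (rule has_derivative_bounded_linear)
  have "((\<lambda>t. t *\<^sub>R x) has_derivative (\<lambda>t. t *\<^sub>R x)) (at (1::real))"
    by (auto intro!: derivative_eq_intros)
  then have "((\<lambda>t. p (t *\<^sub>R x)) has_derivative (\<lambda>t. p' (t *\<^sub>R x))) (at 1)"
    using p' by (intro has_derivative_compose[where f = "\<lambda>t. t *\<^sub>R x" and g = p]) auto
  then have "((\<lambda>t. t ^ d * p x) has_derivative (\<lambda>t. p' (t *\<^sub>R x))) (at 1)"
    by (simp add: scale)
  moreover have "((\<lambda>t. t ^ d * p x) has_derivative (\<lambda>t. t * (real d * p x))) (at 1)"
    by (auto intro!: derivative_eq_intros)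
  ultimately have "(\<lambda>t. p' (t *\<^sub>R x)) = (\<lambda>t. t * (real d * p x))"
    by (rule has_derivative_unique)
  then have "p' x = real d * p x" by (metis mult_1 scaleR_one)
  moreover have "p' x = p' (\<Sum>i\<in>UNIV. x $ i *\<^sub>R axis i 1)"
    by (simp add: basis_expansion scalar_mult_eq_scaleR[symmetric])
  ultimately show ?thesis
    by (simp add: p'.sum p'.scaleR partial_deriv_eq[OF p'])
qed

section \<open>Powers of \<open>1 + r^2\<close> and their products with harmonic polynomials\<close>

lemma sum_nth_power2: "(\<Sum>i\<in>UNIV. (x $ i)\<^sup>2) = (norm (x :: real ^ 'n::finite))\<^sup>2"
  by (simp add: norm_vec_def L2_set_def sum_nonneg)

lemma has_derivative_one_plus_norm2_powr:
  "((\<lambda>x::real ^ 'n::finite. (1 + (norm x)\<^sup>2) powr a) has_derivative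
     (\<lambda>h. 2 * a * (x \<bullet> h) * (1 + (norm x)\<^sup>2) powr (a - 1))) (at x)"
proof -
  \<comment> \<open>The inner product replaces the squared norm because \<open>norm\<close> itself
    is not differentiable at the origin.\<close>
  have pos: "1 + x \<bullet> x > 0" by (simp add: add_pos_nonneg)
  then have "((\<lambda>x. (1 + x \<bullet> x) powr a) has_derivative
     (\<lambda>h. 2 * a * (x \<bullet> h) * (1 + x \<bullet> x) powr (a - 1))) (at x)"
    by (auto intro!: derivative_eq_intros simp: powr_diff inner_commute field_simps)
  then show ?thesis by (simp add: power2_norm_eq_inner)
qed

lemma partial_deriv_one_plus_norm2_powr:
  "partial_deriv i (\<lambda>x. (1 + (norm x)\<^sup>2) powr a)
     = (\<lambda>x. 2 * a * (x $ i * (1 + (norm x)\<^sup>2) powr (a - 1)))"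
  by (auto simp: partial_deriv_eq[OF has_derivative_one_plus_norm2_powr] inner_axis)

text \<open>A partial derivative is a constant times a coordinate times the power with exponent
  \<open>a - 1\<close>; hence the induction for all \<open>a\<close> at once.\<close>

lemma C_class_one_plus_norm2_powr:
  "C_class m (\<lambda>x :: real ^ 'n::finite. (1 + (norm x)\<^sup>2) powr a)"
proof (induction m arbitrary: a)
  case 0
  have "1 + (norm x)\<^sup>2 \<noteq> 0" for x :: "real ^ 'n"
    by (metis add_pos_nonneg less_irrefl zero_le_power2 zero_less_one)
  then show ?case by (auto intro!: continuous_intros)
next
  case (Suc m)
  have "(\<lambda>x :: real ^ 'n. (1 + (norm x)\<^sup>2) powr a) differentiable (at x)" for x
    using has_derivative_one_plus_norm2_powr by (rule differentiableI)
  then show ?case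
    using Suc by (auto simp: partial_deriv_one_plus_norm2_powr
        intro!: C_class_mult C_class_const C_class_nth)
qed

lemma laplacian_one_plus_norm2_powr:
  fixes x :: "real ^ 'n::finite"
  shows "laplacian (\<lambda>x. (1 + (norm x)\<^sup>2) powr a) x
    = 2 * a * real CARD('n) * (1 + (norm x)\<^sup>2) powr (a - 1)
      + 4 * a * (a - 1) * (norm x)\<^sup>2 * (1 + (norm x)\<^sup>2) powr (a - 2)"
proof -
  have "partial_deriv i (partial_deriv i (\<lambda>x. (1 + (norm x)\<^sup>2) powr a)) x
     = 2 * a * (1 + (norm x)\<^sup>2) powr (a - 1)
       + (4 * a * (a - 1) * (1 + (norm x)\<^sup>2) powr (a - 2)) * (x $ i)\<^sup>2" for i
  proof -
    have d: "(\<lambda>x::real^'n. x $ i * (1 + (norm x)\<^sup>2) powr (a - 1)) differentiable at x"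
      "(\<lambda>x::real^'n. (1 + (norm x)\<^sup>2) powr (a - 1)) differentiable at x"
      "(\<lambda>x::real^'n. x $ i) differentiable at x"
      by (rule C_class_differentiable, (intro C_class_mult C_class_nth C_class_one_plus_norm2_powr))+
    show ?thesis
      unfolding partial_deriv_one_plus_norm2_powr
      by (subst partial_deriv_mult, simp, rule d, subst partial_deriv_mult, rule d, rule d)
        (simp add: partial_deriv_const partial_deriv_nth partial_deriv_one_plus_norm2_powr,
         simp add: algebra_simps power2_eq_square)
  qed
  then show ?thesis
    by (simp add: laplacian_def sum.distrib sum_distrib_left[symmetric] sum_nth_power2)
qed

text \<open>In the product rule Euler's identity evaluates the mixed term, and
  \<open>r^2 = u - 1\<close> with \<open>u = 1 + r^2\<close> replaces
  \<open>r^2 * u powr (a - 2)\<close> by a difference of two powers of \<open>u\<close>.\<close>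

lemma laplacian_powr_mult_harmonic:
  fixes p :: "real ^ 'n::finite \<Rightarrow> real"
  assumes p: "homogeneous_polynomial d p" and harm: "\<And>x. laplacian p x = 0"
  shows "laplacian (\<lambda>x. (1 + (norm x)\<^sup>2) powr a * p x) x
    = 4 * a * (a - 1 + real CARD('n) / 2 + real d) * ((1 + (norm x)\<^sup>2) powr (a - 1) * p x)
      - 4 * a * (a - 1) * ((1 + (norm x)\<^sup>2) powr (a - 2) * p x)"
proof -
  define u where "u = 1 + (norm x)\<^sup>2"
  have u: "u > 0" by (simp add: u_def add_pos_nonneg)
  have "(\<Sum>i\<in>UNIV. partial_deriv i (\<lambda>x. (1 + (norm x)\<^sup>2) powr a) x * partial_deriv i p x)
     = 2 * a * u powr (a - 1) * (\<Sum>i\<in>UNIV. x $ i * partial_deriv i p x)"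
    by (simp only: partial_deriv_one_plus_norm2_powr u_def sum_distrib_left) (simp add: mult_ac)
  also have "\<dots> = 2 * a * u powr (a - 1) * (real d * p x)"
    by (simp add: euler_homogeneous[OF p])
  finally have cross: "(\<Sum>i\<in>UNIV. partial_deriv i (\<lambda>x. (1 + (norm x)\<^sup>2) powr a) x
      * partial_deriv i p x) = 2 * a * u powr (a - 1) * (real d * p x)" .
  have "u powr (a - 1) = u * u powr (a - 2)"
    using u powr_mult_base[of u "a - 2"] by simp
  then show ?thesis
    using cross
    by (simp add: laplacian_mult C_class_one_plus_norm2_powr C_class_homogeneous_polynomial[OF p]
        harm laplacian_one_plus_norm2_powr u_def[symmetric])
       (simp add: u_def algebra_simps)
qed

section \<open>The third power of the Laplacian\<close>

lemma C_class_laplacian: "C_class (Suc (Suc m)) f \<Longrightarrow> C_class m (laplacian f)"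
  unfolding laplacian_def[abs_def] by (intro C_class_sum) simp

text \<open>Linearity is applied to functions of class \<open>C_class 2\<close>, so every iteration
  uses up two orders of differentiability.\<close>

lemma laplacian_funpow_sum:
  assumes "\<And>i. i \<in> I \<Longrightarrow> C_class (2 * m) (f i)"
  shows "(laplacian ^^ m) (\<lambda>x. \<Sum>i\<in>I. g i * f i x) = (\<lambda>x. \<Sum>i\<in>I. g i * (laplacian ^^ m) (f i) x)"
  using assms
proof (induction m arbitrary: f)
  case (Suc m)
  have f: "C_class 2 (f i)" "C_class (2 * m) (laplacian (f i))" if "i \<in> I" for i
    using Suc.prems[OF that] C_class_mono[of 2 "2 * Suc m" "f i"] by (auto intro: C_class_laplacian)
  have "laplacian (\<lambda>x. \<Sum>i\<in>I. g i * f i x) = (\<lambda>x. \<Sum>i\<in>I. g i * laplacian (f i) x)"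
    by (rule ext, subst laplacian_sum) (auto simp: laplacian_cmult f intro!: C_class_mult C_class_const)
  then show ?case
    using Suc.IH[of "\<lambda>i. laplacian (f i)"] f(2)
    by (simp add: funpow_Suc_right del: funpow.simps)
qed simp

text \<open>The coefficient of \<open>u powr (a - 1) * p\<close> in the Laplacian of
  \<open>u powr a * p\<close>; \<open>lap_lo a\<close> is minus the coefficient of
  \<open>u powr (a - 2) * p\<close>.\<close>

definition lap_hi :: "real \<Rightarrow> real \<Rightarrow> real \<Rightarrow> real" where
  "lap_hi n d a = 4 * a * (a - 1 + n / 2 + d)"

definition lap_lo :: "real \<Rightarrow> real" where
  "lap_lo a = 4 * a * (a - 1)"

text \<open>Each of three applications of the two-term formula lowers the exponent by 1 or 2. The
  eight resulting products are grouped by the total drop, from 3 to 6.\<close>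

lemma laplacian3_powr_mult_harmonic:
  fixes p :: "real ^ 'n::finite \<Rightarrow> real" and a :: real
  assumes p: "homogeneous_polynomial d p" and harm: "\<And>x. laplacian p x = 0"
  defines "c \<equiv> lap_hi (real CARD('n)) (real d)"
  shows "(laplacian ^^ 3) (\<lambda>x. (1 + (norm x)\<^sup>2) powr a * p x) x
    = (c a * c (a - 1) * c (a - 2) * (1 + (norm x)\<^sup>2) powr (a - 3)
       - (c a * c (a - 1) * lap_lo (a - 2) + c a * lap_lo (a - 1) * c (a - 3)
          + lap_lo a * c (a - 2) * c (a - 3)) * (1 + (norm x)\<^sup>2) powr (a - 4)
       + (c a * lap_lo (a - 1) * lap_lo (a - 3) + lap_lo a * c (a - 2) * lap_lo (a - 3)
          + lap_lo a * lap_lo (a - 2) * c (a - 4)) * (1 + (norm x)\<^sup>2) powr (a - 5)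
       - lap_lo a * lap_lo (a - 2) * lap_lo (a - 4) * (1 + (norm x)\<^sup>2) powr (a - 6)) * p x"
proof -
  define h where "h b x = (1 + (norm x)\<^sup>2) powr b * p x" for b x
  have h: "C_class m (h b)" for m b
    unfolding h_def[abs_def]
    by (intro C_class_mult C_class_one_plus_norm2_powr C_class_homogeneous_polynomial[OF p])
  have 1: "laplacian (h b) x = c b * h (b - 1) x + (- lap_lo b) * h (b - 2) x" for b x
    unfolding h_def[abs_def] laplacian_powr_mult_harmonic[OF assms(1,2)] c_def lap_hi_def lap_lo_def
    by simp
  have lin: "laplacian (\<lambda>x. \<alpha> * h b x + f x) x = \<alpha> * laplacian (h b) x + laplacian f x"
    if "C_class 2 f" for \<alpha> b f x
    using that by (simp add: laplacian_add laplacian_cmult C_class_mult C_class_const h)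
  have lin1: "laplacian (\<lambda>x. \<alpha> * h b x) x = \<alpha> * laplacian (h b) x" for \<alpha> b x
    by (simp add: laplacian_cmult h)
  have C: "C_class 2 (\<lambda>x. \<alpha> * h b x)" "C_class 2 f \<Longrightarrow> C_class 2 (\<lambda>x. \<alpha> * h b x + f x)" for \<alpha> b f
    by (simp_all add: C_class_add C_class_mult C_class_const h)
  have 2: "laplacian (laplacian (h b)) = (\<lambda>x. (c b * c (b - 1)) * h (b - 2) x
      + ((- (c b * lap_lo (b - 1) + lap_lo b * c (b - 2))) * h (b - 3) x
      + (lap_lo b * lap_lo (b - 2)) * h (b - 4) x))" for b
  proof
    fix x
    have "laplacian (h b) = (\<lambda>x. c b * h (b - 1) x + (- lap_lo b) * h (b - 2) x)"
      using 1 by (rule ext)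
    then have "laplacian (laplacian (h b)) x
        = laplacian (\<lambda>x. c b * h (b - 1) x + (- lap_lo b) * h (b - 2) x) x"
      by (rule arg_cong)
    also have "\<dots> = c b * laplacian (h (b - 1)) x + (- lap_lo b) * laplacian (h (b - 2)) x"
      by (simp only: lin C lin1)
    finally show "laplacian (laplacian (h b)) x = (c b * c (b - 1)) * h (b - 2) x
      + ((- (c b * lap_lo (b - 1) + lap_lo b * c (b - 2))) * h (b - 3) x
      + (lap_lo b * lap_lo (b - 2)) * h (b - 4) x)"
      by (simp add: 1 algebra_simps)
  qed
  have "(laplacian ^^ 3) (h a) x = laplacian (laplacian (laplacian (h a))) x"
    by (simp add: eval_nat_numeral)
  also have "\<dots> = (c a * c (a - 1)) * laplacian (h (a - 2)) x
      + ((- (c a * lap_lo (a - 1) + lap_lo a * c (a - 2))) * laplacian (h (a - 3)) x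
      + (lap_lo a * lap_lo (a - 2)) * laplacian (h (a - 4)) x)"
    by (simp only: 2 lin lin1 C C_class_mult C_class_const h)
  finally have "(laplacian ^^ 3) (h a) x
    = c a * c (a - 1) * (c (a - 2) * h (a - 3) x - lap_lo (a - 2) * h (a - 4) x)
      - (c a * lap_lo (a - 1) + lap_lo a * c (a - 2))
        * (c (a - 3) * h (a - 4) x - lap_lo (a - 3) * h (a - 5) x)
      + lap_lo a * lap_lo (a - 2) * (c (a - 4) * h (a - 5) x - lap_lo (a - 4) * h (a - 6) x)"
    unfolding 1 by (simp add: algebra_simps)
  then show ?thesis
    unfolding h_def[abs_def] by (simp add: algebra_simps)
qed

subsection \<open>Alternating binomial sums\<close>

text \<open>Both sides are \<open>u ^ r / fact r\<close> times the \<open>r\<close>-th derivative of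
  \<open>(u - 1) ^ s\<close> in \<open>u\<close>. The proof uses the product identity for binomial
  coefficients and the binomial theorem.\<close>

lemma binomial_sum_choose:
  fixes u :: real
  shows "(\<Sum>l\<le>s. real (s choose l) * (- 1) ^ (s - l) * u ^ l * real (l choose r))
    = real (s choose r) * u ^ r * (u - 1) ^ (s - r)"
proof (cases "r \<le> s")
  case True
  have "(\<Sum>l\<le>s. real (s choose l) * (- 1) ^ (s - l) * u ^ l * real (l choose r))
    = (\<Sum>l\<in>{r..s}. real (s choose l) * (- 1) ^ (s - l) * u ^ l * real (l choose r))"
    by (rule sum.mono_neutral_right) auto
  also have "\<dots> = (\<Sum>m\<le>s - r. real (s choose (m + r)) * (- 1) ^ (s - (m + r)) * u ^ (m + r)
      * real ((m + r) choose r))"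
    by (rule sum.reindex_bij_witness[of _ "\<lambda>m. m + r" "\<lambda>l. l - r"]) (use True in auto)
  also have "\<dots> = (\<Sum>m\<le>s - r. real (s choose r) * u ^ r
      * (real ((s - r) choose m) * u ^ m * (- 1) ^ (s - r - m)))"
  proof (rule sum.cong)
    fix m assume "m \<in> {..s - r}"
    then have "(s choose (m + r)) * ((m + r) choose r) = (s choose r) * ((s - r) choose m)"
      using choose_mult[of r "m + r" s] True by simp
    then have "real (s choose (m + r)) * real ((m + r) choose r)
        = real (s choose r) * real ((s - r) choose m)"
      by (metis of_nat_mult)
    then show "real (s choose (m + r)) * (- 1) ^ (s - (m + r)) * u ^ (m + r) * real ((m + r) choose r)
      = real (s choose r) * u ^ r * (real ((s - r) choose m) * u ^ m * (- 1) ^ (s - r - m))"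
      by (simp add: power_add diff_diff_add add.commute[of r] mult_ac)
  qed simp
  also have "\<dots> = real (s choose r) * u ^ r * (u - 1) ^ (s - r)"
    using binomial_ring[of u "- 1" "s - r"] by (simp add: sum_distrib_left)
  finally show ?thesis .
next
  case False
  then show ?thesis by (auto intro!: sum.neutral simp: binomial_eq_0)
qed

lemma real_choose_small:
  "real (m choose 2) = real m * (real m - 1) / 2"
  "real (m choose 3) = real m * (real m - 1) * (real m - 2) / 6"
  "real (m choose 4) = real m * (real m - 1) * (real m - 2) * (real m - 3) / 24"
  by (simp_all add: binomial_gbinomial gbinomial_prod_rev eval_nat_numeral prod.atLeast0_lessThan_Suc
      lessThan_Suc fact_numeral field_simps)

text \<open>The \<open>r\<close>-th forward difference at 0, which is the coefficient of
  \<open>l choose r\<close> in Newton's expansion.\<close>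

primrec fdiff :: "nat \<Rightarrow> (real \<Rightarrow> real) \<Rightarrow> real" where
  "fdiff 0 f = f 0"
| "fdiff (Suc r) f = fdiff r (\<lambda>x. f (x + 1)) - fdiff r f"

text \<open>Where \<open>s - r\<close> truncates, the binomial coefficient vanishes, so powers of
  \<open>v\<close> can be merged without comparing \<open>r\<close> and \<open>s\<close>.\<close>

lemma power_mult_choose:
  "real (s choose r) * v ^ (s - r) * v ^ i = real (s choose r) * v ^ (s + i - r)" for v :: real
  by (cases "r \<le> s") (auto simp: power_add[symmetric] mult.assoc)

subsection \<open>Factorization of the linearized operator\<close>

text \<open>Everything is expressed on the monomials \<open>u ^ j\<close>, the factor \<open>u powr (1 - n / 2)\<close> being split off;
  \<open>fac_\<close> gives the coefficients of the second-order factor and \<open>cofac_\<close> those of the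
  fourth-order one. The former is \<open>2 * (S - eig n 1)\<close>, where \<open>S\<close> is, up to affine
  normalization, the spherical Laplacian and \<open>eig n i\<close> its coefficient from \<open>u ^ i\<close> to itself.
  The latter comes from dividing \<open>-64 * S * (S + 4) * (S + 6)\<close>, less its value at \<open>S = eig n 1\<close>,
  by this factor.\<close>

definition fac_hi :: "real \<Rightarrow> real \<Rightarrow> real \<Rightarrow> real" where
  "fac_hi n d j = (d + j - 2) * (n - 2 * j + 2)"

definition fac_lo :: "real \<Rightarrow> real \<Rightarrow> real" where
  "fac_lo n j = 2 * (j - 1) * (n - j + 2)"

definition eig :: "real \<Rightarrow> real \<Rightarrow> real" where
  "eig n i = (i + 1 - n / 2) * (i - 4 - n / 2)"

definition cofac_hi :: "real \<Rightarrow> real \<Rightarrow> real \<Rightarrow> real" where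
  "cofac_hi n d i = - 32 * (i - 1 - n / 2) * (i - n / 2) * (d + i - 2) * (d + i - 1)"

definition cofac_mid :: "real \<Rightarrow> real \<Rightarrow> real \<Rightarrow> real" where
  "cofac_mid n d i = 32 * (i - 1 - n / 2) * (d + i - 2) * (eig n i + eig n (i + 1) + eig n 1 + 10)"

definition cofac_lo :: "real \<Rightarrow> real \<Rightarrow> real" where
  "cofac_lo n i = - 32 * ((eig n i)\<^sup>2 + eig n i * eig n 1 + (eig n 1)\<^sup>2 + 10 * (eig n i + eig n 1) + 24)"

text \<open>All three are polynomials of degree at most four in \<open>l\<close>, so Newton's
  expansion stops at \<open>r = 4\<close>. The shift by 4 is there because the cofactor will act on
  the monomials \<open>u ^ (l + 4)\<close> of \<open>u ^ 4 * v ^ s\<close>.\<close>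

lemma newton_cofac:
  "cofac_hi n d (real l + 4) = (\<Sum>r\<le>4. fdiff r (\<lambda>l. cofac_hi n d (l + 4)) * real (l choose r))"
  "cofac_mid n d (real l + 4) = (\<Sum>r\<le>4. fdiff r (\<lambda>l. cofac_mid n d (l + 4)) * real (l choose r))"
  "cofac_lo n (real l + 4) = (\<Sum>r\<le>4. fdiff r (\<lambda>l. cofac_lo n (l + 4)) * real (l choose r))"
proof -
  have "{..4::nat} = {0, 1, 2, 3, 4}" by auto
  then show
  "cofac_hi n d (real l + 4) = (\<Sum>r\<le>4. fdiff r (\<lambda>l. cofac_hi n d (l + 4)) * real (l choose r))"
  "cofac_mid n d (real l + 4) = (\<Sum>r\<le>4. fdiff r (\<lambda>l. cofac_mid n d (l + 4)) * real (l choose r))"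
  "cofac_lo n (real l + 4) = (\<Sum>r\<le>4. fdiff r (\<lambda>l. cofac_lo n (l + 4)) * real (l choose r))"
    by (simp_all add: real_choose_small,
      simp_all add: eval_nat_numeral cofac_hi_def cofac_mid_def cofac_lo_def eig_def field_simps)
qed

text \<open>Comparison of the coefficients of \<open>u ^ (j + 3)\<close> down to
  \<open>u ^ j\<close> in the composition of the two factors. In the last one, the product of the
  \<open>lap_lo\<close> is \<open>64 * E * (E + 4) * (E + 6)\<close> at \<open>E = eig n j\<close>,
  and the added constant is the same polynomial at \<open>E = eig n 1\<close>. Their difference is
  divisible by \<open>eig n j - eig n 1 = - fac_lo n j / 2\<close>.\<close>

lemma laplacian3_factorization:
  fixes n d j :: real
  defines "a \<equiv> j + 1 - n / 2" and "c \<equiv> lap_hi n d"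
  shows "c a * c (a - 1) * c (a - 2) = fac_hi n d j * cofac_hi n d (j + 1)"
    and "- (c a * c (a - 1) * lap_lo (a - 2) + c a * lap_lo (a - 1) * c (a - 3)
          + lap_lo a * c (a - 2) * c (a - 3)) = fac_hi n d j * cofac_mid n d (j + 1) - fac_lo n j * cofac_hi n d j"
    and "c a * lap_lo (a - 1) * lap_lo (a - 3) + lap_lo a * c (a - 2) * lap_lo (a - 3)
          + lap_lo a * lap_lo (a - 2) * c (a - 4) = fac_hi n d j * cofac_lo n (j + 1) - fac_lo n j * cofac_mid n d j"
    and "- (lap_lo a * lap_lo (a - 2) * lap_lo (a - 4))
          + (n - 4) * (n - 2) * n * (n + 2) * (n + 4) * (n + 6) = - fac_lo n j * cofac_lo n j"
  unfolding a_def c_def lap_hi_def lap_lo_def fac_hi_def fac_lo_def cofac_hi_def cofac_mid_def cofac_lo_def eig_def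
  by (simp_all add: field_simps power2_eq_square)

text \<open>By Newton's forward difference formula the cofactor applied to \<open>u ^ 4 * v ^ s\<close> is a combination of
  the terms \<open>(s choose r) * u ^ r * v ^ (s - r)\<close>. Homogenizing with \<open>1 = u - v\<close> leaves one
  identity for each power of \<open>u\<close>.\<close>

lemma cofac_coefficients:
  fixes n k s :: real
  defines "X \<equiv> \<lambda>r. fdiff r (\<lambda>l. cofac_hi n (k - 2 * s) (l + 4))"
  defines "Y \<equiv> \<lambda>r. fdiff r (\<lambda>l. cofac_mid n (k - 2 * s) (l + 4))"
  defines "Z \<equiv> \<lambda>r. fdiff r (\<lambda>l. cofac_lo n (l + 4))"
  shows "Z 0 = - 2 * c5 n"
    and "s * Z 1 - (Y 0 + 2 * Z 0) = - 2 * c4 n k"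
    and "s * (s - 1) / 2 * Z 2 - s * (Y 1 + 2 * Z 1) + (X 0 + Y 0 + Z 0) = - 2 * c3 n k s"
    and "s * (s - 1) * (s - 2) / 6 * Z 3 - s * (s - 1) / 2 * (Y 2 + 2 * Z 2)
           + s * (X 1 + Y 1 + Z 1) = - 2 * c2 n k s"
    and "s * (s - 1) * (s - 2) * (s - 3) / 24 * Z 4 - s * (s - 1) * (s - 2) / 6 * (Y 3 + 2 * Z 3)
           + s * (s - 1) / 2 * (X 2 + Y 2 + Z 2) = - 2 * c1 n k s"
    and "s * (s - 1) * (s - 2) / 6 * (X 3 + Y 3 + Z 3)
           - s * (s - 1) * (s - 2) * (s - 3) / 24 * (Y 4 + 2 * Z 4) = 0"
    and "X 4 + Y 4 + Z 4 = 0"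
  unfolding X_def Y_def Z_def
  by (simp_all add: eval_nat_numeral cofac_hi_def cofac_mid_def cofac_lo_def eig_def c1_def c2_def c3_def c4_def c5_def,
    (simp add: field_simps)+)

text \<open>The fourth-order factor sends \<open>u ^ i\<close> to
  \<open>u ^ i * cofac n d u i\<close>.\<close>

definition cofac :: "real \<Rightarrow> real \<Rightarrow> real \<Rightarrow> real \<Rightarrow> real" where
  "cofac n d u i = cofac_hi n d i * u\<^sup>2 + cofac_mid n d i * u + cofac_lo n i"

text \<open>As \<open>v ^ s = (u - 1) ^ s\<close>, the left side is the fourth-order factor applied
  to \<open>u ^ 4 * v ^ s\<close>, with the common factor \<open>u ^ 4\<close> taken out.\<close>

lemma binomial_sum_cofac:
  fixes n k v :: real and s :: nat
  defines "u \<equiv> 1 + v"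
  shows "(\<Sum>l\<le>s. real (s choose l) * (- 1) ^ (s - l) * u ^ l * cofac n (k - 2 * real s) u (real l + 4))
    = - 2 * (c1 n k s * v ^ (s - 2) * u ^ 4 + c2 n k s * v ^ (s - 1) * u ^ 3
        + c3 n k s * v ^ s * u\<^sup>2 + c4 n k * v ^ (s + 1) * u + c5 n * v ^ (s + 2))"
proof -
  define X where "X r = fdiff r (\<lambda>l. cofac_hi n (k - 2 * real s) (l + 4))" for r
  define Y where "Y r = fdiff r (\<lambda>l. cofac_mid n (k - 2 * real s) (l + 4))" for r
  define Z where "Z r = fdiff r (\<lambda>l. cofac_lo n (l + 4))" for r
  \<comment> \<open>\<open>V q\<close> complements \<open>u ^ q\<close> to total degree
    \<open>s + 2\<close> in \<open>u\<close> and \<open>v\<close>. Wherever this exponent truncates,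
    the binomial coefficient in front is zero.\<close>
  define V where "V q = v ^ (s + 2 - q)" for q
  define b where "b r = real (s choose r)" for r
  have b: "b 0 = 1" "b 1 = real s" "b 2 = real s * (real s - 1) / 2"
    "b 3 = real s * (real s - 1) * (real s - 2) / 6"
    "b 4 = real s * (real s - 1) * (real s - 2) * (real s - 3) / 24"
    by (simp_all add: b_def real_choose_small)
  have bV: "b r * v ^ (s - r) = b r * V (r + 2)" "b r * v ^ (s - r) * v = b r * V (r + 1)"
    "b r * v ^ (s - r) * v\<^sup>2 = b r * V r" for r
    using power_mult_choose[of s r v 0] power_mult_choose[of s r v 1] power_mult_choose[of s r v 2]
    by (simp_all add: b_def V_def)
  have "(\<Sum>l\<le>s. real (s choose l) * (- 1) ^ (s - l) * u ^ l * cofac n (k - 2 * real s) u (real l + 4))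
    = (\<Sum>l\<le>s. \<Sum>r\<le>4. (X r * u\<^sup>2 + Y r * u + Z r)
        * (real (s choose l) * (- 1) ^ (s - l) * u ^ l * real (l choose r)))"
    unfolding cofac_def newton_cofac X_def[symmetric] Y_def[symmetric] Z_def[symmetric]
    by (simp only: sum_distrib_left sum_distrib_right sum.distrib[symmetric])
      (simp add: algebra_simps)
  also have "\<dots> = (\<Sum>r\<le>4. (X r * u\<^sup>2 + Y r * u + Z r) * (b r * u ^ r * v ^ (s - r)))"
    by (subst sum.swap) (simp add: sum_distrib_left[symmetric] binomial_sum_choose u_def b_def)
  also have "\<dots> = (\<Sum>r\<le>4. b r * (Z r * u ^ r * V r - (Y r + 2 * Z r) * u ^ (r + 1) * V (r + 1)
      + (X r + Y r + Z r) * u ^ (r + 2) * V (r + 2)))"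
  proof (rule sum.cong)
    fix r
    have "(X r * u\<^sup>2 + Y r * u + Z r) * (b r * u ^ r * v ^ (s - r))
      = (X r * u\<^sup>2 + Y r * u * (u - v) + Z r * (u - v)\<^sup>2) * (b r * u ^ r * v ^ (s - r))"
      by (simp add: u_def)
    also have "\<dots> = Z r * u ^ r * (b r * v ^ (s - r) * v\<^sup>2)
        - (Y r + 2 * Z r) * u ^ (r + 1) * (b r * v ^ (s - r) * v)
        + (X r + Y r + Z r) * u ^ (r + 2) * (b r * v ^ (s - r))"
      by (simp add: algebra_simps power2_eq_square)
    also have "\<dots> = Z r * u ^ r * (b r * V r)
        - (Y r + 2 * Z r) * u ^ (r + 1) * (b r * V (r + 1))
        + (X r + Y r + Z r) * u ^ (r + 2) * (b r * V (r + 2))"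
      unfolding bV(3) unfolding bV(2) unfolding bV(1) ..
    finally show "(X r * u\<^sup>2 + Y r * u + Z r) * (b r * u ^ r * v ^ (s - r))
      = b r * (Z r * u ^ r * V r - (Y r + 2 * Z r) * u ^ (r + 1) * V (r + 1)
      + (X r + Y r + Z r) * u ^ (r + 2) * V (r + 2))"
      by (simp add: algebra_simps)
  qed simp
  \<comment> \<open>Collected by \<open>u ^ q * V q\<close>; the contributions come from
    \<open>r = q\<close>, \<open>r = q - 1\<close> and \<open>r = q - 2\<close>.\<close>
  also have "\<dots> = Z 0 * V 0
    + (real s * Z 1 - (Y 0 + 2 * Z 0)) * (u * V 1)
    + (b 2 * Z 2 - real s * (Y 1 + 2 * Z 1) + (X 0 + Y 0 + Z 0)) * (u\<^sup>2 * V 2)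
    + (b 3 * Z 3 - b 2 * (Y 2 + 2 * Z 2) + real s * (X 1 + Y 1 + Z 1)) * (u ^ 3 * V 3)
    + (b 4 * Z 4 - b 3 * (Y 3 + 2 * Z 3) + b 2 * (X 2 + Y 2 + Z 2)) * (u ^ 4 * V 4)
    + (b 3 * (X 3 + Y 3 + Z 3) - b 4 * (Y 4 + 2 * Z 4)) * (u ^ 5 * V 5)
    + b 4 * (X 4 + Y 4 + Z 4) * (u ^ 6 * V 6)"
  proof -
    have "{..4::nat} = {0, 1, 2, 3, 4}" by auto
    then show ?thesis by (simp add: b(1) b(2)[unfolded One_nat_def])
      (simp add: eval_nat_numeral algebra_simps)
  qed
  \<comment> \<open>The last two coefficients vanish, the other five yield \<open>c5\<close> to
    \<open>c1\<close>. \<open>Z 0\<close> also occurs inside later coefficients, so its own value is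
    inserted last.\<close>
  also have "\<dots> = - 2 * (c1 n k s * V 4 * u ^ 4 + c2 n k s * V 3 * u ^ 3
        + c3 n k s * V 2 * u\<^sup>2 + c4 n k * V 1 * u + c5 n * V 0)"
    unfolding b X_def Y_def Z_def unfolding cofac_coefficients(2-7) unfolding cofac_coefficients(1) by (simp add: algebra_simps)
  finally show ?thesis by (simp add: V_def)
qed

section \<open>The coefficient recursion: its effect on sums and its solvability\<close>

text \<open>Summation by parts: \<open>u ^ (j + 1) * f (j + 1)\<close> receives \<open>fac_hi n d j
  * \<Gamma> j - fac_lo n (j + 1) * \<Gamma> (j + 1)\<close>, and the recursion makes these the
  coefficients of \<open>- 1 / 2 * u ^ 4 * (u - 1) ^ s\<close>. The weight \<open>f\<close> will be
  the cofactor.\<close>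

lemma sum_recursion:
  fixes \<Gamma> :: "nat \<Rightarrow> real" and n d u :: real and s :: nat
  assumes rec12: "fac_hi n d 1 * \<Gamma> 1 = fac_lo n 2 * \<Gamma> 2" "fac_hi n d 2 * \<Gamma> 2 = fac_lo n 3 * \<Gamma> 3"
    and rec: "\<And>j. j \<in> {3..s + 2} \<Longrightarrow> fac_hi n d (real j) * \<Gamma> j
      = fac_lo n (real j + 1) * \<Gamma> (j + 1) - (- 1) ^ (s + 3 - j) / 2 * real (s choose (j - 3))"
    and last: "fac_hi n d (real s + 3) * \<Gamma> (s + 3) = - 1 / 2"
  shows "(\<Sum>j=1..s+3. \<Gamma> j * u ^ j * (fac_hi n d (real j) * u * f (real j + 1) - fac_lo n (real j) * f (real j)))
    = - 1 / 2 * (\<Sum>l\<le>s. real (s choose l) * (- 1) ^ (s - l) * u ^ (l + 4) * f (real l + 4))"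
proof -
  \<comment> \<open>With \<open>\<Gamma>\<close> cut off beyond \<open>s + 3\<close> the recursion also holds in its last, inhomogeneous case.\<close>
  define \<Gamma>' where "\<Gamma>' j = (if j \<le> s + 3 then \<Gamma> j else 0)" for j
  define t where "t j = fac_lo n (real j) * \<Gamma>' j * u ^ j * f (real j)" for j
  define g where "g l = real (s choose l) * (- 1) ^ (s - l) * u ^ (l + 4) * f (real l + 4)" for l
  have eq: "fac_hi n d (real l + 3) * \<Gamma>' (l + 3) = fac_lo n (real l + 4) * \<Gamma>' (l + 4)
      - (- 1) ^ (s - l) / 2 * real (s choose l)" if "l \<le> s" for l
  proof (cases "l = s")
    case False
    with that have "l + 3 \<in> {3..s + 2}" by auto
    from rec[OF this] show ?thesis
      using that False by (simp add: \<Gamma>'_def add.commute[of _ "real l"] numeral_eq_Suc)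
  qed (use last in \<open>simp add: \<Gamma>'_def\<close>)
  have "(\<Sum>j=1..s+3. \<Gamma> j * u ^ j * (fac_hi n d (real j) * u * f (real j + 1) - fac_lo n (real j) * f (real j)))
    = (\<Sum>j=1..s+3. fac_hi n d (real j) * \<Gamma>' j * u ^ (j + 1) * f (real j + 1) - t j)"
    by (rule sum.cong) (auto simp: \<Gamma>'_def t_def algebra_simps)
  also have "\<dots> = (\<Sum>j=1..s+3. (t (Suc j) - t j) - (if j \<ge> 3 then g (j - 3) / 2 else 0))"
  proof (rule sum.cong)
    fix j assume "j \<in> {1..s + 3}"
    then have "j = 1 \<or> j = 2 \<or> j = (j - 3) + 3 \<and> j - 3 \<le> s" by auto
    then consider "j = 1" | "j = 2" | l where "j = l + 3" "l \<le> s" by blast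
    then show "fac_hi n d (real j) * \<Gamma>' j * u ^ (j + 1) * f (real j + 1) - t j
      = (t (Suc j) - t j) - (if j \<ge> 3 then g (j - 3) / 2 else 0)"
    proof cases
      case (3 l)
      then show ?thesis
        by (simp add: eq t_def g_def) (simp add: algebra_simps)
    qed (use rec12 in \<open>simp_all add: t_def \<Gamma>'_def eval_nat_numeral\<close>)
  qed simp
  also have "\<dots> = (\<Sum>j=1..s+3. t (Suc j) - t j) - (\<Sum>j=1..s+3. if j \<ge> 3 then g (j - 3) / 2 else 0)"
    by (simp add: sum_subtractf)
  also have "(\<Sum>j=1..s+3. t (Suc j) - t j) = t (Suc (s + 3)) - t 1"
    by (rule sum_Suc_diff) simp
  \<comment> \<open>The lower boundary term vanishes by \<open>fac_lo n 1 = 0\<close>, the upper one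
    by the cutoff in \<open>\<Gamma>'\<close>.\<close>
  also have "\<dots> = 0" by (simp add: t_def \<Gamma>'_def fac_lo_def)
  also have "(\<Sum>j=1..s+3. if j \<ge> 3 then g (j - 3) / 2 else 0) = (\<Sum>j=3..s+3. g (j - 3) / 2)"
    by (rule sum.mono_neutral_cong_right) auto
  also have "\<dots> = (\<Sum>l\<le>s. g l / 2)"
    by (rule sum.reindex_bij_witness[of _ "\<lambda>l. l + 3" "\<lambda>j. j - 3"]) auto
  finally show ?thesis
    by (simp add: g_def sum_divide_distrib[symmetric])
qed

text \<open>The coefficients are determined downwards from the top index, so primitive recursion
  runs on the distance \<open>N - j\<close>.\<close>

lemma backward_recursion:
  "\<exists>\<Gamma>. \<Gamma> N = b \<and> (\<forall>j<N. \<Gamma> j = F j (\<Gamma> (Suc j)))"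
proof -
  define \<Gamma> where "\<Gamma> j = rec_nat b (\<lambda>m y. F (N - Suc m) y) (N - j)" for j
  have "\<Gamma> j = F j (\<Gamma> (Suc j))" if "j < N" for j
  proof -
    from that have "N - j = Suc (N - Suc j)" "N - Suc (N - Suc j) = j" by auto
    then show ?thesis by (simp only: \<Gamma>_def nat.rec)
  qed
  moreover have "\<Gamma> N = b" by (simp add: \<Gamma>_def)
  ultimately show ?thesis by blast
qed

section \<open>Construction of the coefficients and verification of the differential
  equation\<close>

theorem proposition10p18:
  fixes n k s :: nat
  assumes "n = CARD('n::finite)" and "n \<ge> 12"
    and "k \<in> {2..n - 10}" and "s \<in> {0..(k - 2) div 2}"
  shows "\<exists>\<Gamma> :: nat \<Rightarrow> real.
      (real k - 2 * real s - 1) * \<Gamma> 1 = 2 * \<Gamma> 2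
    \<and> (real k - 2 * real s) * \<Gamma> 2 = 4 * (real n - 1) / (real n - 2) * \<Gamma> 3
    \<and> (\<forall>j\<in>{3..s + 2}.
          (real k - 2 * real s + real j - 2) * \<Gamma> j
            = 2 * real j * (real n - real j + 1) / (real n - 2 * real j + 2) * \<Gamma> (j + 1)
              - (- 1) ^ (s + 3 - j) / (2 * (real n - 2 * real j + 2)) * real (s choose (j - 3)))
    \<and> (real k - real s + 1) * \<Gamma> (s + 3) = - (1 / (2 * (real n - 2 * real s - 4)))
    \<and> (\<forall>p :: real ^ 'n \<Rightarrow> real.
          homogeneous_polynomial (k - 2 * s) p \<and> (\<forall>x. laplacian p x = 0) \<longrightarrow>
          C_class 6 (Psi \<Gamma> n s p) \<and>
          (\<forall>x. (laplacian ^^ 3) (Psi \<Gamma> n s p) x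
                 + (real n - 4) * (real n - 2) * real n * (real n + 2) * (real n + 4) * (real n + 6)
                     * (1 + (norm x)^2) powr (- 6) * Psi \<Gamma> n s p x
               = - L1w n k s p x))"
proof -
  define N where "N = real n"
  define d where "d = real k - 2 * real s"
  have "2 * s + 2 \<le> k" "k + 10 \<le> n" using assms(2-4) by auto
  then have sk: "2 * real s + 2 \<le> real k" and kn: "real k + 10 \<le> N"
    unfolding N_def by linarith+
  \<comment> \<open>These are the divisors of the recursion. They are positive because
    \<open>d \<ge> 2\<close> and, in the worst case \<open>j = s + 3\<close>,
    \<open>N - 2 * s - 4 \<ge> 8\<close> by \<open>2 * s \<le> k - 2 \<le> n - 12\<close>.\<close>
  have A_pos: "d + real j - 2 > 0" "N - 2 * real j + 2 > 0" "fac_hi N d (real j) > 0"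
    if "1 \<le> j" "j \<le> s + 3" for j
  proof -
    from that have "1 \<le> real j" "real j \<le> real s + 3" by linarith+
    then show "d + real j - 2 > 0" "N - 2 * real j + 2 > 0" using sk kn by (auto simp: d_def)
    then show "fac_hi N d (real j) > 0" by (simp add: fac_hi_def)
  qed
  \<comment> \<open>The inhomogeneity after multiplication by \<open>N - 2 * j + 2\<close>. The case
    distinction matters: for \<open>j < 3\<close> the truncated \<open>j - 3\<close> would give
    \<open>s choose 0 = 1\<close>.\<close>
  define g where "g j = (if j \<ge> 3 then (- 1) ^ (s + 3 - j) / 2 * real (s choose (j - 3)) else 0)" for j
  obtain \<Gamma> :: "nat \<Rightarrow> real" where last: "\<Gamma> (s + 3) = - 1 / 2 / fac_hi N d (real (s + 3))"
    and \<Gamma>: "\<And>j. j < s + 3 \<Longrightarrow> \<Gamma> j = (fac_lo N (real j + 1) * \<Gamma> (Suc j) - g j) / fac_hi N d (real j)"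
    using backward_recursion[of "s + 3" "- 1 / 2 / fac_hi N d (real (s + 3))"
      "\<lambda>j y. (fac_lo N (real j + 1) * y - g j) / fac_hi N d (real j)"] by auto
  have last: "fac_hi N d (real s + 3) * \<Gamma> (s + 3) = - 1 / 2"
    using last A_pos(3)[of "s + 3"] by (simp add: add.commute)
  have rec: "fac_hi N d (real j) * \<Gamma> j = fac_lo N (real j + 1) * \<Gamma> (j + 1) - g j" if "1 \<le> j" "j \<le> s + 2" for j
    using \<Gamma>[of j] A_pos(3)[of j] that by (simp add: field_simps)
  have rec12: "fac_hi N d 1 * \<Gamma> 1 = fac_lo N 2 * \<Gamma> 2" "fac_hi N d 2 * \<Gamma> 2 = fac_lo N 3 * \<Gamma> 3"
    using rec[of 1] rec[of 2] by (simp_all add: g_def eval_nat_numeral)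
  have rec3: "fac_hi N d (real j) * \<Gamma> j
      = fac_lo N (real j + 1) * \<Gamma> (j + 1) - (- 1) ^ (s + 3 - j) / 2 * real (s choose (j - 3))"
    if "j \<in> {3..s + 2}" for j
    using rec[of j] that by (simp add: g_def)
  have "(real k - 2 * real s - 1) * \<Gamma> 1 = 2 * \<Gamma> 2"
  proof -
    \<comment> \<open>Here \<open>fac_hi N d 1 = (d - 1) * N\<close> and
      \<open>fac_lo N 2 = 2 * N\<close>, so \<open>N\<close> cancels.\<close>
    have "N * ((d - 1) * \<Gamma> 1) = N * (2 * \<Gamma> 2)"
      using rec12(1) by (simp add: fac_hi_def fac_lo_def algebra_simps)
    then show ?thesis using kn by (simp add: d_def)
  qed
  moreover have "(real k - 2 * real s) * \<Gamma> 2 = 4 * (real n - 1) / (real n - 2) * \<Gamma> 3"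
  proof -
    have "d * \<Gamma> 2 * (N - 2) = 4 * (N - 1) * \<Gamma> 3"
      using rec12(2) by (simp add: fac_hi_def fac_lo_def algebra_simps)
    moreover have "N - 2 \<noteq> 0" using kn by auto
    ultimately have "d * \<Gamma> 2 = 4 * (N - 1) / (N - 2) * \<Gamma> 3" by (simp add: eq_divide_eq)
    then show ?thesis by (simp add: d_def N_def)
  qed
  moreover have "(real k - 2 * real s + real j - 2) * \<Gamma> j
      = 2 * real j * (real n - real j + 1) / (real n - 2 * real j + 2) * \<Gamma> (j + 1)
        - (- 1) ^ (s + 3 - j) / (2 * (real n - 2 * real j + 2)) * real (s choose (j - 3))"
    if j: "j \<in> {3..s + 2}" for j
  proof -
    define D where "D = N - 2 * real j + 2"
    have D: "D \<noteq> 0" using A_pos(2)[of j] j by (simp add: D_def)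
    have "((d + real j - 2) * \<Gamma> j) * D
      = 2 * real j * (N - real j + 1) * \<Gamma> (j + 1) - (- 1) ^ (s + 3 - j) / 2 * real (s choose (j - 3))"
      using rec3[OF j] by (simp add: fac_hi_def fac_lo_def D_def mult_ac)
    then have "(d + real j - 2) * \<Gamma> j = (2 * real j * (N - real j + 1) * \<Gamma> (j + 1)
        - (- 1) ^ (s + 3 - j) / 2 * real (s choose (j - 3))) / D"
      by (rule eq_divide_imp[OF D])
    also have "\<dots> = 2 * real j * (N - real j + 1) / D * \<Gamma> (j + 1)
        - (- 1) ^ (s + 3 - j) / (2 * D) * real (s choose (j - 3))"
      by (simp add: diff_divide_distrib)
    finally have "(d + real j - 2) * \<Gamma> j = 2 * real j * (N - real j + 1) / D * \<Gamma> (j + 1)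
        - (- 1) ^ (s + 3 - j) / (2 * D) * real (s choose (j - 3))" .
    then show ?thesis by (simp add: d_def D_def N_def)
  qed
  moreover have "(real k - real s + 1) * \<Gamma> (s + 3) = - (1 / (2 * (real n - 2 * real s - 4)))"
  proof -
    \<comment> \<open>At \<open>j = s + 3\<close> the factor \<open>d + j - 2\<close> of
      \<open>fac_hi\<close> equals \<open>k - s + 1\<close>.\<close>
    have "real n - 2 * real s - 4 \<noteq> 0" using A_pos(2)[of "s + 3"] by (simp add: N_def)
    then show ?thesis
      using last by (simp add: fac_hi_def d_def N_def field_simps)
  qed
  moreover have "C_class 6 (Psi \<Gamma> n s p) \<and>
      (\<forall>x. (laplacian ^^ 3) (Psi \<Gamma> n s p) x
         + (real n - 4) * (real n - 2) * real n * (real n + 2) * (real n + 4) * (real n + 6)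
             * (1 + (norm x)^2) powr (- 6) * Psi \<Gamma> n s p x
       = - L1w n k s p x)"
    if p: "homogeneous_polynomial (k - 2 * s) p" and harm: "\<And>x. laplacian p x = 0"
    for p :: "real ^ 'n \<Rightarrow> real"
  proof -
    define C where "C = (real n - 6) / (4 * (real n - 1))"
    define a where "a j = real j + 1 - N / 2" for j
    define K where "K = (N - 4) * (N - 2) * N * (N + 2) * (N + 4) * (N + 6)"
    have d: "real (k - 2 * s) = d"
      using \<open>2 * s + 2 \<le> k\<close> by (simp add: d_def of_nat_diff)
    have a: "- ((real n - 2 - 2 * real j) / 2) = a j" for j
      by (simp add: a_def N_def field_simps)
    have Psi: "Psi \<Gamma> n s p = (\<lambda>x. \<Sum>j=1..s+3. (C * \<Gamma> j) * ((1 + (norm x)\<^sup>2) powr a j * p x))"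
      by (rule ext) (simp only: Psi_def C_def[symmetric] a sum_distrib_left mult.assoc)
    have smooth: "C_class m (\<lambda>x. (1 + (norm x)\<^sup>2) powr a j * p x)" for m j
      by (intro C_class_mult C_class_one_plus_norm2_powr C_class_homogeneous_polynomial[OF p])
    have "C_class 6 (Psi \<Gamma> n s p)"
      unfolding Psi by (intro C_class_sum C_class_mult[OF C_class_const] smooth)
    moreover have "(laplacian ^^ 3) (Psi \<Gamma> n s p) x
        + K * (1 + (norm x)\<^sup>2) powr (- 6) * Psi \<Gamma> n s p x = - L1w n k s p x" for x
    proof -
      define v where "v = (norm x)\<^sup>2"
      define u where "u = 1 + v"
      \<comment> \<open>The lowest exponent that occurs is \<open>a j - 6 = j - 5 - N / 2\<close>;
        with \<open>U\<close> split off, only natural powers of \<open>u\<close> remain.\<close>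
      define U where "U = u powr (- 5 - N / 2)"
      have u: "u > 0" by (simp add: u_def v_def add_pos_nonneg)
      have powr_U: "u powr b = U * u ^ i" if "b = real i - 5 - N / 2" for b i
      proof -
        have "b = (- 5 - N / 2) + real i" using that by simp
        then show ?thesis using u by (simp only: powr_add U_def powr_realpow)
      qed
      \<comment> \<open>The second-order factor followed by the cofactor. The weight
        \<open>u powr (- 6)\<close> lowers the exponent to \<open>a j - 6\<close>, the lowest one
        produced by the cubed Laplacian, so \<open>K\<close> joins that coefficient only.\<close>
      have summand: "(laplacian ^^ 3) (\<lambda>x. (1 + (norm x)\<^sup>2) powr a j * p x) x
          + K * u powr (- 6) * (u powr a j * p x)
        = U * p x * (u ^ j * (fac_hi N d (real j) * u * cofac N d u (real j + 1)
            - fac_lo N (real j) * cofac N d u (real j)))" for j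
      proof -
        have pw: "u powr (a j - 3) = U * u ^ (j + 3)" "u powr (a j - 4) = U * u ^ (j + 2)"
          "u powr (a j - 5) = U * u ^ (j + 1)" "u powr (a j - 6) = U * u ^ j"
          by (intro powr_U; simp add: a_def)+
        have 6: "u powr (- 6) * (u powr a j * p x) = u powr (a j - 6) * p x"
          by (simp add: powr_add[symmetric] mult.assoc[symmetric])
        note fact = laplacian3_factorization(1-3)[where j = "real j" and n = N and d = d, folded a_def]
          laplacian3_factorization(4)[where j = "real j" and n = N, folded a_def]
        have "(laplacian ^^ 3) (\<lambda>x. (1 + (norm x)\<^sup>2) powr a j * p x) x
            + K * u powr (- 6) * (u powr a j * p x)
          = (lap_hi N d (a j) * lap_hi N d (a j - 1) * lap_hi N d (a j - 2) * u powr (a j - 3)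
            + - (lap_hi N d (a j) * lap_hi N d (a j - 1) * lap_lo (a j - 2)
                + lap_hi N d (a j) * lap_lo (a j - 1) * lap_hi N d (a j - 3)
                + lap_lo (a j) * lap_hi N d (a j - 2) * lap_hi N d (a j - 3)) * u powr (a j - 4)
            + (lap_hi N d (a j) * lap_lo (a j - 1) * lap_lo (a j - 3)
                + lap_lo (a j) * lap_hi N d (a j - 2) * lap_lo (a j - 3)
                + lap_lo (a j) * lap_lo (a j - 2) * lap_hi N d (a j - 4)) * u powr (a j - 5)
            + (- (lap_lo (a j) * lap_lo (a j - 2) * lap_lo (a j - 4)) + K) * u powr (a j - 6)) * p x"
          unfolding laplacian3_powr_mult_harmonic[OF p harm] assms(1)[symmetric] d
            N_def[symmetric] v_def[symmetric] u_def[symmetric] mult.assoc[of K] 6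
          by (simp add: algebra_simps)
        also have "\<dots> = U * p x * (u ^ j * (fac_hi N d (real j) * u * cofac N d u (real j + 1)
            - fac_lo N (real j) * cofac N d u (real j)))"
          unfolding K_def fact pw cofac_def by (simp add: power_add eval_nat_numeral algebra_simps)
        finally show ?thesis .
      qed
      have "(laplacian ^^ 3) (Psi \<Gamma> n s p) x + K * (1 + (norm x)\<^sup>2) powr (- 6) * Psi \<Gamma> n s p x
        = (\<Sum>j=1..s+3. (C * \<Gamma> j) * ((laplacian ^^ 3) (\<lambda>x. (1 + (norm x)\<^sup>2) powr a j * p x) x
          + K * u powr (- 6) * (u powr a j * p x)))"
        unfolding Psi by (subst laplacian_funpow_sum[OF smooth])
          (simp add: u_def v_def sum_distrib_left sum.distrib algebra_simps)
      also have "\<dots> = C * U * p x * (\<Sum>j=1..s+3. \<Gamma> j * u ^ j *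
          (fac_hi N d (real j) * u * cofac N d u (real j + 1) - fac_lo N (real j) * cofac N d u (real j)))"
        unfolding summand by (simp add: sum_distrib_left mult_ac)
      \<comment> \<open>The recursion enters here, with weight \<open>cofac N d u\<close>: the
        second-order factor has turned the sum into \<open>- 1 / 2 * u ^ 4 * v ^ s\<close>.\<close>
      also have "\<dots> = C * U * p x * (- 1 / 2 * (\<Sum>l\<le>s. real (s choose l) * (- 1) ^ (s - l)
          * u ^ (l + 4) * cofac N d u (real l + 4)))"
        by (subst sum_recursion[OF rec12 rec3 last]) auto
      also have "(\<Sum>l\<le>s. real (s choose l) * (- 1) ^ (s - l) * u ^ (l + 4) * cofac N d u (real l + 4))
        = u ^ 4 * (\<Sum>l\<le>s. real (s choose l) * (- 1) ^ (s - l) * u ^ l * cofac N d u (real l + 4))"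
        by (simp add: power_add sum_distrib_left mult_ac)
      also have "\<dots> = u ^ 4 * (- 2 * (c1 N (real k) (real s) * v ^ (s - 2) * u ^ 4
          + c2 N (real k) (real s) * v ^ (s - 1) * u ^ 3 + c3 N (real k) (real s) * v ^ s * u\<^sup>2
          + c4 N (real k) * v ^ (s + 1) * u + c5 N * v ^ (s + 2)))"
        unfolding d_def u_def by (subst binomial_sum_cofac) simp
      also have "C * U * p x * (- 1 / 2 * \<dots>) = C * (c1 N (real k) (real s) * v ^ (s - 2) * (U * u ^ 8)
          + c2 N (real k) (real s) * v ^ (s - 1) * (U * u ^ 7)
          + c3 N (real k) (real s) * v ^ s * (U * u ^ 6)
          + c4 N (real k) * v ^ (s + 1) * (U * u ^ 5) + c5 N * v ^ (s + 2) * (U * u ^ 4)) * p x"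
        by (simp add: eval_nat_numeral algebra_simps)
      also have "\<dots> = - L1w n k s p x"
      proof -
        have pw: "u powr (- ((N - 6) / 2)) = U * u ^ 8" "u powr (- ((N - 4) / 2)) = U * u ^ 7"
          "u powr (- ((N - 2) / 2)) = U * u ^ 6" "u powr (- (N / 2)) = U * u ^ 5"
          "u powr (- ((N + 2) / 2)) = U * u ^ 4"
          by (intro powr_U; simp add: field_simps)+
        have nv: "norm x powi (2 * int i) = v ^ i" for i
          unfolding v_def power_mult[symmetric] by (simp flip: power_int_of_nat)
        \<comment> \<open>For \<open>s < 2\<close> the integer power has a negative exponent while
          \<open>s - 2\<close> truncates to 0; both sides vanish through \<open>c1\<close>. The same
          happens with \<open>c2\<close> at \<open>s = 0\<close>.\<close>
        have "c1 N (real k) (real s) * norm x powi (2 * int s - 4)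
            = c1 N (real k) (real s) * v ^ (s - 2)"
        proof (cases "s \<ge> 2")
          case True
          then show ?thesis using nv[of "s - 2"] by (simp add: of_nat_diff algebra_simps)
        next
          case False
          then have "s = 0 \<or> s = 1" by auto
          then show ?thesis by (auto simp: c1_def)
        qed
        moreover have "c2 N (real k) (real s) * norm x powi (2 * int s - 2)
            = c2 N (real k) (real s) * v ^ (s - 1)"
        proof (cases "s \<ge> 1")
          case True
          then show ?thesis using nv[of "s - 1"] by (simp add: of_nat_diff algebra_simps)
        qed (simp add: c2_def)
        moreover have "norm x powi (2 * int s + 2) = v ^ (s + 1)" "norm x powi (2 * int s + 4) = v ^ (s + 2)"
          using nv[of "s + 1"] nv[of "s + 2"] by (simp_all add: algebra_simps)
        ultimately show ?thesis
          unfolding L1w_def N_def[symmetric] v_def[symmetric] u_def[symmetric] pw nv C_def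
          by (simp only: mult_minus_left minus_minus)
      qed
      finally show ?thesis .
    qed
    ultimately show ?thesis by (simp add: K_def N_def)
  qed
  ultimately show ?thesis by blast
qed

end
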